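(* Let $n\in\mathbb{N}$, $a,b\in\mathbb{R}$, $c\in\mathbb{R}\setminus\{0\}$, $1<p<\infty$, and let $L\in\mathbb{R}$ with $L\neq\pm\frac{n+2-p}{n(1-p)}$. Set $$\alpha=\frac{n+2-p-Ln(1-p)}{2(n+1)(1-p)},\qquad \beta=\frac{n+2-p+Ln(1-p)}{2(n+1)(1-p)},$$ $$g(y_1,y_2)=c(y_1-a)^{n+1}+i(n+1)(y_2-b),\qquad h(y_1,y_2)=c(y_1-a)^{n+1}-i(n+1)(y_2-b),$$ and $$f_{p,L}(y_1,y_2)=g(y_1,y_2)^{\alpha}\,h(y_1,y_2)^{\beta}.$$ Then on the Grushin-type plane $\mathbb{G}_n$ one has $$\mathcal{G}_{p,L}(f_{p,L}):=\Delta_pf_{p,L}+iL\,[Y_1,Y_2]\left(\|\nabla_0f_{p,L}\|_{\mathbb{G}}^{p-2}\,f_{p,L}\right)=C\delta_{(a,b)}$$ for some constant $C$, in the sense of distributions.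
   Context: The Grushin-type plane $\mathbb{G}_n$ (with parameters $a\in\mathbb{R}$, $c\in\mathbb{R}\setminus\{0\}$, $n\in\mathbb{N}$) is $\mathbb{R}^2$ with coordinates $(y_1,y_2)$ and the vector fields $$Y_1=\frac{\partial}{\partial y_1},\qquad Y_2=c(y_1-a)^n\frac{\partial}{\partial y_2},\qquad [Y_1,Y_2]=cn(y_1-a)^{n-1}\frac{\partial}{\partial y_2}.$$ A (singular) inner product on $\mathbb{R}^2$, with norm $\|\cdot\|_{\mathbb{G}}$, is chosen so that $\{Y_1,Y_2\}$ is orthonormal. The horizontal gradient is $\nabla_0f=(Y_1f,Y_2f)$; for complex-valued $f$, $\|\nabla_0f\|_{\mathbb{G}}^2=Y_1f\,\overline{Y_1f}+Y_2f\,\overline{Y_2f}$. The $p$-Laplacian is $$\Delta_pf=Y_1\left(\|\nabla_0f\|_{\mathbb{G}}^{p-2}Y_1f\right)+Y_2\left(\|\nabla_0f\|_{\mathbb{G}}^{p-2}Y_2f\right).$$ $\delta_{(a,b)}$ is the Dirac mass at the point $(a,b)$, the common zero of $g$ and $h$. *)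

theory Defs
  imports "HOL-Analysis.Analysis"
begin

section \<open>Vector fields on the plane acting on functions and distributions\<close>

definition pd1 :: "(real \<times> real \<Rightarrow> 'a::real_normed_vector) \<Rightarrow> real \<times> real \<Rightarrow> 'a" where
  "pd1 f y = vector_derivative (\<lambda>t. f (t, snd y)) (at (fst y))"

definition pd2 :: "(real \<times> real \<Rightarrow> 'a::real_normed_vector) \<Rightarrow> real \<times> real \<Rightarrow> 'a" where
  "pd2 f y = vector_derivative (\<lambda>t. f (fst y, t)) (at (snd y))"

text \<open>A vector field is given by its pair of coefficients with respect to the coordinate fields.\<close>

type_synonym vfield = "real \<times> real \<Rightarrow> real \<times> real"

definition vf_apply ::
    "vfield \<Rightarrow> (real \<times> real \<Rightarrow> 'a::real_normed_vector) \<Rightarrow> real \<times> real \<Rightarrow> 'a" where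
  "vf_apply V f y = fst (V y) *\<^sub>R pd1 f y + snd (V y) *\<^sub>R pd2 f y"

text \<open>In coordinates, \<open>[V, W]\<^sup>j = V(W\<^sup>j) - W(V\<^sup>j)\<close>.\<close>

definition lie_bracket :: "vfield \<Rightarrow> vfield \<Rightarrow> vfield" where
  "lie_bracket V W y = vf_apply V W y - vf_apply W V y"

fun cont_diff :: "nat \<Rightarrow> (real \<times> real \<Rightarrow> complex) \<Rightarrow> bool" where
  "cont_diff 0 \<phi> \<longleftrightarrow> continuous_on UNIV \<phi>"
| "cont_diff (Suc k) \<phi> \<longleftrightarrow>
     (\<forall>y. \<phi> differentiable (at y)) \<and> cont_diff k (pd1 \<phi>) \<and> cont_diff k (pd2 \<phi>)"

definition test_function :: "(real \<times> real \<Rightarrow> complex) \<Rightarrow> bool" where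
  "test_function \<phi> \<longleftrightarrow> (\<forall>k. cont_diff k \<phi>) \<and> compact (closure {y. \<phi> y \<noteq> 0})"

text \<open>The formal transpose of \<open>V\<close>: \<open>\<phi> \<mapsto> - (\<partial>\<^sub>1(V\<^sup>1 \<phi>) + \<partial>\<^sub>2(V\<^sup>2 \<phi>))\<close>.\<close>

definition vf_transpose ::
    "vfield \<Rightarrow> (real \<times> real \<Rightarrow> complex) \<Rightarrow> real \<times> real \<Rightarrow> complex" where
  "vf_transpose V \<phi> y =
     - (pd1 (\<lambda>z. fst (V z) *\<^sub>R \<phi> z) y + pd2 (\<lambda>z. snd (V z) *\<^sub>R \<phi> z) y)"

text \<open>
  \<open>vf_distr V u\<close> is the distribution \<open>V u\<close>, that is
  \<open>V\<^sup>1 \<partial>\<^sub>1 u + V\<^sup>2 \<partial>\<^sub>2 u\<close> with the derivatives of \<open>u\<close> taken in the sense of distributions.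
  The Bochner integral is \<open>0\<close> when the integrand is not integrable, so the pairing is meaningful
  only under \<open>vf_distr_defined V u\<close>. This condition does not ask for \<open>u\<close> itself to be
  locally integrable: zeros of the coefficients of \<open>V\<close> may compensate singularities of \<open>u\<close>.
  Integration is over \<open>lebesgue\<close> rather than \<open>lborel\<close> because \<open>u\<close> will involve
  pointwise derivatives, which carry arbitrary values on the null set where they do not exist.
\<close>

definition vf_distr ::
    "vfield \<Rightarrow> (real \<times> real \<Rightarrow> complex) \<Rightarrow> (real \<times> real \<Rightarrow> complex) \<Rightarrow> complex" where
  "vf_distr V u \<phi> = (\<integral>y. u y * vf_transpose V \<phi> y \<partial>lebesgue)"

definition vf_distr_defined :: "vfield \<Rightarrow> (real \<times> real \<Rightarrow> complex) \<Rightarrow> bool" where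
  "vf_distr_defined V u \<longleftrightarrow>
     (\<forall>\<phi>. test_function \<phi> \<longrightarrow> integrable lebesgue (\<lambda>y. u y * vf_transpose V \<phi> y))"

definition dirac :: "real \<times> real \<Rightarrow> (real \<times> real \<Rightarrow> complex) \<Rightarrow> complex" where
  "dirac x \<phi> = \<phi> x"


section \<open>The Grushin-type plane\<close>

definition Y1 :: vfield where
  "Y1 y = (1, 0)"

definition Y2 :: "real \<Rightarrow> real \<Rightarrow> nat \<Rightarrow> vfield" where
  "Y2 a c n y = (0, c * (fst y - a) ^ n)"

lemma lie_bracket_Y1_Y2:
  "lie_bracket Y1 (Y2 a c n) y = (0, c * real n * (fst y - a) ^ (n - 1))"
proof -
  have "((\<lambda>t. (0::real, c * (t - a) ^ n)) has_vector_derivative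
      (0, c * real n * (fst y - a) ^ (n - 1))) (at (fst y))"
    unfolding has_vector_derivative_def
    by (auto intro!: derivative_eq_intros simp: fun_eq_iff)
  then have "pd1 (Y2 a c n) y = (0, c * real n * (fst y - a) ^ (n - 1))"
    by (simp add: pd1_def Y2_def vector_derivative_at)
  moreover have "pd1 Y1 y = 0" "pd2 Y1 y = 0"
    by (simp_all add: pd1_def pd2_def Y1_def)
  ultimately show ?thesis
    by (simp add: lie_bracket_def vf_apply_def Y1_def[of y] Y2_def[of a c n y])
qed

text \<open>
  The horizontal gradient is recorded by its components in the orthonormal frame
  \<open>Y\<^sub>1, Y\<^sub>2\<close>. The norm of \<open>complex \<times> complex\<close> is then the norm
  \<open>(Y\<^sub>1f * cnj (Y\<^sub>1f) + Y\<^sub>2f * cnj (Y\<^sub>2f))\<^bsup>1/2\<^esup>\<close> of the Grushin-type plane.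
\<close>

definition hgrad ::
    "real \<Rightarrow> real \<Rightarrow> nat \<Rightarrow> (real \<times> real \<Rightarrow> complex) \<Rightarrow> real \<times> real \<Rightarrow> complex \<times> complex" where
  "hgrad a c n f y = (vf_apply Y1 f y, vf_apply (Y2 a c n) f y)"

lemma norm_hgrad:
  "complex_of_real ((norm (hgrad a c n f y))\<^sup>2) =
     vf_apply Y1 f y * cnj (vf_apply Y1 f y) +
     vf_apply (Y2 a c n) f y * cnj (vf_apply (Y2 a c n) f y)"
  by (simp add: hgrad_def norm_Pair complex_norm_square[symmetric])

text \<open>The case distinction is needed because \<open>0 powr 0 = 0\<close>.\<close>

definition hgrad_weight ::
    "real \<Rightarrow> real \<Rightarrow> nat \<Rightarrow> real \<Rightarrow> (real \<times> real \<Rightarrow> complex) \<Rightarrow> real \<times> real \<Rightarrow> complex" where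
  "hgrad_weight a c n p f y =
     of_real (if p = 2 then 1 else norm (hgrad a c n f y) powr (p - 2))"

text \<open>
  In the two operators below the inner derivatives, those in the gradient of \<open>f\<close>, are pointwise;
  the outer ones are taken in the sense of distributions.
\<close>

definition p_laplacian ::
    "real \<Rightarrow> real \<Rightarrow> nat \<Rightarrow> real \<Rightarrow> (real \<times> real \<Rightarrow> complex) \<Rightarrow>
     (real \<times> real \<Rightarrow> complex) \<Rightarrow> complex" where
  "p_laplacian a c n p f \<phi> =
     vf_distr Y1 (\<lambda>y. hgrad_weight a c n p f y * vf_apply Y1 f y) \<phi> +
     vf_distr (Y2 a c n) (\<lambda>y. hgrad_weight a c n p f y * vf_apply (Y2 a c n) f y) \<phi>"

definition G_op ::
    "real \<Rightarrow> real \<Rightarrow> nat \<Rightarrow> real \<Rightarrow> real \<Rightarrow> (real \<times> real \<Rightarrow> complex) \<Rightarrow>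
     (real \<times> real \<Rightarrow> complex) \<Rightarrow> complex" where
  "G_op a c n p L f \<phi> =
     p_laplacian a c n p f \<phi> +
     \<i> * of_real L *
       vf_distr (lie_bracket Y1 (Y2 a c n)) (\<lambda>y. hgrad_weight a c n p f y * f y) \<phi>"

definition G_op_defined ::
    "real \<Rightarrow> real \<Rightarrow> nat \<Rightarrow> real \<Rightarrow> (real \<times> real \<Rightarrow> complex) \<Rightarrow> bool" where
  "G_op_defined a c n p f \<longleftrightarrow>
     vf_distr_defined Y1 (\<lambda>y. hgrad_weight a c n p f y * vf_apply Y1 f y) \<and>
     vf_distr_defined (Y2 a c n) (\<lambda>y. hgrad_weight a c n p f y * vf_apply (Y2 a c n) f y) \<and>
     vf_distr_defined (lie_bracket Y1 (Y2 a c n)) (\<lambda>y. hgrad_weight a c n p f y * f y)"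


section \<open>The candidate fundamental solution\<close>

definition alpha_exp :: "nat \<Rightarrow> real \<Rightarrow> real \<Rightarrow> real" where
  "alpha_exp n p L = (real n + 2 - p - L * real n * (1 - p)) / (2 * (real n + 1) * (1 - p))"

definition beta_exp :: "nat \<Rightarrow> real \<Rightarrow> real \<Rightarrow> real" where
  "beta_exp n p L = (real n + 2 - p + L * real n * (1 - p)) / (2 * (real n + 1) * (1 - p))"

definition g_fun :: "real \<Rightarrow> real \<Rightarrow> real \<Rightarrow> nat \<Rightarrow> real \<times> real \<Rightarrow> complex" where
  "g_fun a b c n y =
     of_real (c * (fst y - a) ^ (n + 1)) + \<i> * of_real ((real n + 1) * (snd y - b))"

definition h_fun :: "real \<Rightarrow> real \<Rightarrow> real \<Rightarrow> nat \<Rightarrow> real \<times> real \<Rightarrow> complex" where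
  "h_fun a b c n y =
     of_real (c * (fst y - a) ^ (n + 1)) - \<i> * of_real ((real n + 1) * (snd y - b))"

text \<open>
  Both powers use the principal branch. When \<open>n\<close> is even or \<open>c < 0\<close>, the product may jump
  across the part of the line \<open>y\<^sub>2 = b\<close> on which \<open>c (y\<^sub>1 - a)\<^bsup>n+1\<^esup> < 0\<close>.
\<close>

definition f_sol ::
    "real \<Rightarrow> real \<Rightarrow> real \<Rightarrow> nat \<Rightarrow> real \<Rightarrow> real \<Rightarrow> real \<times> real \<Rightarrow> complex" where
  "f_sol a b c n p L y =
     g_fun a b c n y powr of_real (alpha_exp n p L) *
     h_fun a b c n y powr of_real (beta_exp n p L)"

end

theory Submission
  imports Defs
begin

text \<open>
  Put \<open>x = y\<^sub>1 - a\<close>, \<open>t = y\<^sub>2 - b\<close>. Off the lines \<open>x = 0\<close> and \<open>t = 0\<close>, the flux that is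
  paired with \<open>(\<partial>\<^sub>1\<phi>, \<partial>\<^sub>2\<phi>)\<close> is a scalar multiple
  \<open>m (x, (n + 1) t)\<close> of the Euler field of the dilations \<open>(x, t) \<mapsto> (r x, r\<^bsup>n+1\<^esup> t)\<close>, and \<open>m\<close> is
  homogeneous of degree \<open>-(n + 2)\<close>, minus the homogeneous dimension. Substituting
  \<open>t = \<bar>x\<bar>\<^bsup>n+1\<^esup> \<tau>\<close> and exchanging the integrals leaves, for each fixed \<open>\<tau>\<close>, the integral
  of \<open>d/dx \<phi>(a + x, b + \<bar>x\<bar>\<^bsup>n+1\<^esup> \<tau>)\<close> over each half-line, which is \<open>\<mp> \<phi>(a, b)\<close>. No derivative of
  \<open>m\<close> is taken, so the jump of \<open>f\<close> across the branch cut does no harm.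
\<close>

section \<open>Derivatives of test functions and integrable singularities\<close>

lemma lborel_AE_off_axes:
  fixes a b :: real
  shows "AE y in lborel. fst y \<noteq> a \<and> snd y \<noteq> b"
proof -
  have "negligible {y::real \<times> real. y \<bullet> (1, 0) = a}" "negligible {y::real \<times> real. y \<bullet> (0, 1) = b}"
    by (rule negligible_standard_hyperplane; simp add: Basis_prod_def)+
  note this[THEN negligible_iff_null_sets[THEN iffD1], THEN AE_not_in, unfolded AE_completion_iff]
  from this show ?thesis
    by eventually_elim (simp add: inner_prod_def)
qed

lemma integrable_powr_on_Icc:
  fixes r R :: real
  assumes "r > -1" "R \<ge> 0"
  shows "integrable lborel (\<lambda>x. indicator {-R..R} x * \<bar>x\<bar> powr r :: real)"
proof -
  have "(\<lambda>x. x powr r) absolutely_integrable_on {0..R}"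
    by (rule nonnegative_absolutely_integrable_1) (use assms in \<open>auto intro: integrable_on_powr_from_0\<close>)
  then have "integrable lebesgue (\<lambda>x. indicator {0..R} x * x powr r)"
    by (simp add: set_integrable_def)
  then have *: "integrable lborel (\<lambda>x. indicator {0..R} x * x powr r)"
    by (subst (asm) integrable_completion) auto
  \<comment> \<open>The reflection of x to -x supplies the negative half; the two functions overlap
    only at 0, where \<open>0 powr r = 0\<close>.\<close>
  have "integrable lborel (\<lambda>x. indicator {0..R} (0 + (-1) * x) * (0 + (-1) * x) powr r)"
    by (rule lborel_integrable_real_affine[OF *]) auto
  from Bochner_Integration.integrable_add[OF * this]
  show ?thesis
    by (rule Bochner_Integration.integrable_bound)
      (auto simp: indicator_def intro!: AE_I2)
qed

lemma integrable_product_powr: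
  fixes a b r s R :: real
  assumes "r > -1" "s > -1" "R \<ge> 0"
  shows "integrable lborel (\<lambda>y. (indicator {a-R..a+R} (fst y) * \<bar>fst y - a\<bar> powr r) *
    (indicator {b-R..b+R} (snd y) * \<bar>snd y - b\<bar> powr s))"
proof -
  have *: "integrable lborel (\<lambda>x. indicator {a-R..a+R} x * \<bar>x - a\<bar> powr r)"
    if "r > -1" for a r :: real
  proof -
    have "integrable lborel (\<lambda>x. indicator {-R..R} (-a + 1 * x) * \<bar>-a + 1 * x\<bar> powr r)"
      by (rule lborel_integrable_real_affine[OF integrable_powr_on_Icc]) (use that assms in auto)
    also have "(\<lambda>x. indicator {-R..R} (-a + 1 * x) * \<bar>-a + 1 * x\<bar> powr r) =
        (\<lambda>x. indicator {a-R..a+R} x * \<bar>x - a\<bar> powr r)"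
      by (auto simp: fun_eq_iff indicator_def)
    finally show ?thesis .
  qed
  note int = *[OF assms(1), of a] *[OF assms(2), of b]
  show ?thesis
    unfolding lborel_prod[symmetric]
  proof (rule lborel_pair.Fubini_integrable)
    show "(\<lambda>y. (indicator {a-R..a+R} (fst y) * \<bar>fst y - a\<bar> powr r) *
        (indicator {b-R..b+R} (snd y) * \<bar>snd y - b\<bar> powr s)) \<in> borel_measurable (lborel \<Otimes>\<^sub>M lborel)"
      by measurable
  qed (use int in \<open>auto simp: abs_mult\<close>)
qed

section \<open>Partial derivatives and supports of test functions\<close>

lemma has_derivative_pd:
  assumes "\<phi> differentiable (at y)"
  shows "(\<phi> has_derivative (\<lambda>v. fst v *\<^sub>R pd1 \<phi> y + snd v *\<^sub>R pd2 \<phi> y)) (at y)"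
proof -
  obtain D where D: "(\<phi> has_derivative D) (at y)"
    using assms by (auto simp: differentiable_def)
  interpret D: bounded_linear D using D by (rule has_derivative_bounded_linear)
  have c: "(\<phi> has_derivative D) (at (fst y, snd y))" using D by simp
  have "((\<lambda>t. \<phi> (t, snd y)) has_derivative (\<lambda>h. D (h, 0))) (at (fst y))"
    by (rule has_derivative_compose[of "\<lambda>t. (t, snd y)" "\<lambda>h. (h, 0)" "fst y" UNIV \<phi> D, OF _ c])
      (intro has_derivative_Pair has_derivative_ident has_derivative_const)
  moreover have "(\<lambda>h. D (h, 0)) = (\<lambda>h. h *\<^sub>R D (1, 0))"
    by (auto simp flip: D.scaleR)
  ultimately have 1: "pd1 \<phi> y = D (1, 0)"
    by (simp add: pd1_def vector_derivative_at has_vector_derivative_def)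
  have "((\<lambda>t. \<phi> (fst y, t)) has_derivative (\<lambda>h. D (0, h))) (at (snd y))"
    by (rule has_derivative_compose[of "\<lambda>t. (fst y, t)" "\<lambda>h. (0, h)" "snd y" UNIV \<phi> D, OF _ c])
      (intro has_derivative_Pair has_derivative_ident has_derivative_const)
  moreover have "(\<lambda>h. D (0, h)) = (\<lambda>h. h *\<^sub>R D (0, 1))"
    by (auto simp flip: D.scaleR)
  ultimately have 2: "pd2 \<phi> y = D (0, 1)"
    by (simp add: pd2_def vector_derivative_at has_vector_derivative_def)
  have "D = (\<lambda>v. fst v *\<^sub>R pd1 \<phi> y + snd v *\<^sub>R pd2 \<phi> y)"
    unfolding 1 2 by (auto simp flip: D.scaleR D.add)
  with D show ?thesis by simp
qed

lemma
  assumes "open A" "\<And>y. y \<in> A \<Longrightarrow> \<phi> y = 0" "y \<in> A"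
  shows pd1_eq_0: "pd1 \<phi> y = 0" and pd2_eq_0: "pd2 \<phi> y = 0"
proof -
  have "(\<phi> has_derivative (\<lambda>v. 0)) (at y)"
    by (rule has_derivative_transform_within_open[where f = "\<lambda>_. 0" and s = A]) (use assms in auto)
  moreover from this have "\<phi> differentiable (at y)" by (auto simp: differentiable_def)
  ultimately have *: "(\<lambda>v. fst v *\<^sub>R pd1 \<phi> y + snd v *\<^sub>R pd2 \<phi> y) = (\<lambda>v. 0)"
    by (intro has_derivative_unique[OF has_derivative_pd])
  from fun_cong[OF *, of "(1, 0)"] fun_cong[OF *, of "(0, 1)"]
  show "pd1 \<phi> y = 0" "pd2 \<phi> y = 0" by simp_all
qed

lemma test_functionD:
  assumes "test_function \<phi>"
  shows "\<phi> differentiable (at y)" "continuous_on UNIV (pd1 \<phi>)" "continuous_on UNIV (pd2 \<phi>)"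
proof -
  have "cont_diff (Suc 0) \<phi>" using assms unfolding test_function_def by blast
  then show "\<phi> differentiable (at y)" "continuous_on UNIV (pd1 \<phi>)" "continuous_on UNIV (pd2 \<phi>)"
    by (simp_all del: split_paired_All)
qed

lemma test_function_vanish:
  assumes "test_function \<phi>"
  obtains R where "R > 0"
    "\<And>y. \<bar>fst y - a\<bar> \<ge> R \<or> \<bar>snd y - b\<bar> \<ge> R \<Longrightarrow> \<phi> y = 0 \<and> pd1 \<phi> y = 0 \<and> pd2 \<phi> y = 0"
proof -
  let ?K = "closure {y. \<phi> y \<noteq> 0}"
  have "bounded ?K" using assms by (auto simp: test_function_def compact_imp_bounded)
  then obtain B where B: "B > 0" "\<And>y. y \<in> ?K \<Longrightarrow> norm y \<le> B" unfolding bounded_pos by blast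
  \<comment> \<open>B bounds the support around the origin; adding |a| + |b| recentres it at (a, b),
    and the extra 1 puts y strictly outside the closed support, whose complement is open, so the
    partial derivatives vanish as well.\<close>
  have "\<phi> y = 0 \<and> pd1 \<phi> y = 0 \<and> pd2 \<phi> y = 0"
    if "\<bar>fst y - a\<bar> \<ge> B + \<bar>a\<bar> + \<bar>b\<bar> + 1 \<or> \<bar>snd y - b\<bar> \<ge> B + \<bar>a\<bar> + \<bar>b\<bar> + 1" for y
  proof -
    have "\<bar>fst y\<bar> \<le> norm y" "\<bar>snd y\<bar> \<le> norm y"
      using norm_fst_le[of "fst y" "snd y"] norm_snd_le[of "snd y" "fst y"] by simp_all
    then have "norm y > B" using that by linarith
    then have y: "y \<in> - ?K" using B(2)[of y] by fastforce
    have z: "\<phi> z = 0" if "z \<in> - ?K" for z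
      using that closure_subset[of "{y. \<phi> y \<noteq> 0}"] by blast
    have "open (- ?K)" by (simp add: open_Compl)
    from pd1_eq_0[of _ \<phi>, OF this z y] pd2_eq_0[of _ \<phi>, OF this z y] z[OF y] show ?thesis by blast
  qed
  then show ?thesis using B(1) by (intro that[of "B + \<bar>a\<bar> + \<bar>b\<bar> + 1"]) auto
qed

lemma continuous_bounded_vanish:
  fixes u :: "real \<times> real \<Rightarrow> complex"
  assumes "continuous_on UNIV u" "\<And>y. \<bar>fst y - a\<bar> \<ge> R \<or> \<bar>snd y - b\<bar> \<ge> R \<Longrightarrow> u y = 0"
  obtains N where "N > 0" "\<And>y. norm (u y) \<le> N"
proof -
  let ?Q = "{a-R..a+R} \<times> {b-R..b+R}"
  have "compact (u ` ?Q)"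
    by (intro compact_continuous_image compact_Times continuous_on_subset[OF assms(1)]) auto
  then have "bounded (u ` ?Q)" by (rule compact_imp_bounded)
  then obtain N where N: "N > 0" "\<And>y. y \<in> ?Q \<Longrightarrow> norm (u y) \<le> N"
    by (auto simp only: bounded_pos ball_simps)
  have "norm (u y) \<le> N" for y
  proof (cases "y \<in> ?Q")
    case False
    then have "u y = 0" by (intro assms(2)) (auto simp: mem_Times_iff)
    then show ?thesis using N by simp
  qed (use N in auto)
  with N show ?thesis by (intro that) auto
qed

section \<open>Homogeneous functions paired with the Euler field\<close>

text \<open>For fixed x other than a, sending \<tau> to b + |x - a|^k \<tau> is an affine change of
  variable with Jacobian |x - a|^k, so each fibre integral is preserved. Fubini then puts x
  innermost, ready for integration along the curves of constant \<tau>.\<close>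

lemma shear_integral:
  fixes F :: "real \<times> real \<Rightarrow> complex" and a b :: real and k :: nat
  assumes "integrable lborel F"
  shows "integral\<^sup>L lborel F =
    (\<integral>\<tau>. \<integral>x. \<bar>x - a\<bar> ^ k *\<^sub>R F (x, b + \<bar>x - a\<bar> ^ k * \<tau>) \<partial>lborel \<partial>lborel)"
proof -
  define H where "H x \<tau> = \<bar>x - a\<bar> ^ k *\<^sub>R F (x, b + \<bar>x - a\<bar> ^ k * \<tau>)" for x \<tau>
  have F: "integrable (lborel \<Otimes>\<^sub>M lborel) F" using assms by (simp add: lborel_prod)
  have [measurable]: "F \<in> borel_measurable borel" using borel_measurable_integrable[OF assms] by simp
  have H_int: "(\<integral>\<tau>. H x \<tau> \<partial>lborel) = (\<integral>t. F (x, t) \<partial>lborel)"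
    "(\<integral>\<tau>. norm (H x \<tau>) \<partial>lborel) = (\<integral>t. norm (F (x, t)) \<partial>lborel)" if "x \<noteq> a" for x
    using lborel_integral_real_affine[of "\<bar>x - a\<bar> ^ k" "\<lambda>t. F (x, t)" b]
      lborel_integral_real_affine[of "\<bar>x - a\<bar> ^ k" "\<lambda>t. norm (F (x, t))" b] that
    by (auto simp: H_def)
  have ae: "AE x in lborel. x \<noteq> a" by (rule AE_lborel_singleton)
  have m2: "case_prod H \<in> borel_measurable (lborel \<Otimes>\<^sub>M lborel)"
    unfolding H_def by measurable
  have Hm: "(\<lambda>x. \<integral>\<tau>. H x \<tau> \<partial>lborel) \<in> borel_measurable lborel"
    "(\<lambda>x. \<integral>\<tau>. norm (H x \<tau>) \<partial>lborel) \<in> borel_measurable lborel"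
    using m2 by measurable
  have Fm: "(\<lambda>x. \<integral>t. F (x, t) \<partial>lborel) \<in> borel_measurable lborel"
    "(\<lambda>x. \<integral>t. norm (F (x, t)) \<partial>lborel) \<in> borel_measurable lborel"
    by measurable
  \<comment> \<open>The exchange of integrals needs joint integrability of \<open>H\<close>; it is
    inherited from \<open>F\<close>, because the norms have the same fibre integrals.\<close>
  have "integrable (lborel \<Otimes>\<^sub>M lborel) (case_prod H)"
  proof (rule lborel_pair.Fubini_integrable[OF m2])
    have "integrable lborel (\<lambda>x. \<integral>t. norm (F (x, t)) \<partial>lborel)"
      using lborel_pair.integrable_fst'[OF integrable_norm[OF F]] by simp
    then show "integrable lborel (\<lambda>x. \<integral>y. norm (case (x, y) of (x, y) \<Rightarrow> H x y) \<partial>lborel)"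
      using integrable_cong_AE[OF Hm(2) Fm(2), OF eventually_mono[OF ae H_int(2)]] by simp
    show "AE x in lborel. integrable lborel (\<lambda>y. case (x, y) of (x, y) \<Rightarrow> H x y)"
      using ae lborel_pair.AE_integrable_fst'[OF F]
    proof eventually_elim
      case (elim x)
      then show ?case
        using lborel_integrable_real_affine[of "\<lambda>t. F (x, t)" "\<bar>x - a\<bar> ^ k" b] by (auto simp: H_def)
    qed
  qed
  then have "(\<integral>\<tau>. \<integral>x. H x \<tau> \<partial>lborel \<partial>lborel) = (\<integral>x. \<integral>\<tau>. H x \<tau> \<partial>lborel \<partial>lborel)"
    by (rule lborel_pair.Fubini_integral)
  also have "\<dots> = (\<integral>x. \<integral>t. F (x, t) \<partial>lborel \<partial>lborel)"
    using ae by (intro integral_cong_AE Hm Fm) (auto elim!: eventually_mono simp: H_int)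
  also have "\<dots> = integral\<^sup>L lborel F"
    using lborel_pair.integral_fst'[OF F] by (simp add: lborel_prod)
  finally show ?thesis by (simp add: H_def)
qed

text \<open>The chain rule and the fundamental theorem of calculus. Taking s = 1 to the right of a
  and s = -1 to the left turns |x - a| into s (x - a), so the curve is polynomial and differentiable
  also at its endpoint x = a.\<close>

lemma integral_derivative_along_curve:
  fixes a b s \<tau> u v :: real and n :: nat
  defines "P \<equiv> \<lambda>x. (x, b + (s * (x - a)) ^ (n + 1) * \<tau>)"
  assumes \<phi>: "test_function \<phi>" and "u \<le> v"
  shows "(\<integral>x. indicator {u..v} x *\<^sub>R
      (pd1 \<phi> (P x) + (s * real (n + 1) * (s * (x - a)) ^ n * \<tau>) *\<^sub>R pd2 \<phi> (P x)) \<partial>lborel) =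
    \<phi> (P v) - \<phi> (P u)"
proof (rule integral_FTC_Icc[OF \<open>u \<le> v\<close>])
  fix x
  have P: "(P has_derivative (\<lambda>h. (h, h * (s * real (n + 1) * (s * (x - a)) ^ n * \<tau>)))) (at x)"
    unfolding P_def
    by (auto intro!: derivative_eq_intros simp del: power_Suc simp: fun_eq_iff)
  have "((\<lambda>x. \<phi> (P x)) has_derivative (\<lambda>h. h *\<^sub>R pd1 \<phi> (P x) +
      (h * (s * real (n + 1) * (s * (x - a)) ^ n * \<tau>)) *\<^sub>R pd2 \<phi> (P x))) (at x)"
    using has_derivative_compose[OF P has_derivative_pd[OF test_functionD(1)[OF \<phi>]]] by simp
  then have "((\<lambda>x. \<phi> (P x)) has_vector_derivative
      (pd1 \<phi> (P x) + (s * real (n + 1) * (s * (x - a)) ^ n * \<tau>) *\<^sub>R pd2 \<phi> (P x))) (at x)"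
    by (simp add: has_vector_derivative_def scaleR_add_right mult.assoc)
  then show "((\<lambda>x. \<phi> (P x)) has_vector_derivative
      (pd1 \<phi> (P x) + (s * real (n + 1) * (s * (x - a)) ^ n * \<tau>) *\<^sub>R pd2 \<phi> (P x))) (at x within {u..v})"
    by (rule has_vector_derivative_at_within)
next
  have "continuous_on {u..v} P" unfolding P_def by (intro continuous_intros)
  then show "continuous_on {u..v}
      (\<lambda>x. pd1 \<phi> (P x) + (s * real (n + 1) * (s * (x - a)) ^ n * \<tau>) *\<^sub>R pd2 \<phi> (P x))"
    by (intro continuous_intros continuous_on_compose2[OF test_functionD(2)[OF \<phi>]]
        continuous_on_compose2[OF test_functionD(3)[OF \<phi>]]) auto
qed

text \<open>After the shear, the Jacobian |x - a|^(n+1) and a factor x - a taken out of the Euler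
  field cancel the homogeneity factor of \<open>m\<close> up to the sign of x - a. What remains on
  each half-line is a constant times a total derivative; the sign makes the two boundary terms at
  (a, b) add up.\<close>

lemma integral_homogeneous_euler:
  fixes m :: "real \<times> real \<Rightarrow> complex" and a b :: real and n :: nat
  assumes \<phi>: "test_function \<phi>"
    and hom: "\<And>x \<tau>. x \<noteq> 0 \<Longrightarrow> \<tau> \<noteq> 0 \<Longrightarrow>
      m (a + x, b + \<bar>x\<bar> ^ (n + 1) * \<tau>) = m (a + sgn x, b + \<tau>) /\<^sub>R \<bar>x\<bar> ^ (n + 2)"
    and int: "integrable lborel (\<lambda>y. m y *
      ((fst y - a) *\<^sub>R pd1 \<phi> y + (real (n + 1) * (snd y - b)) *\<^sub>R pd2 \<phi> y))"
  shows "(\<integral>y. m y * ((fst y - a) *\<^sub>R pd1 \<phi> y + (real (n + 1) * (snd y - b)) *\<^sub>R pd2 \<phi> y) \<partial>lborel) =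
    - (\<integral>\<tau>. m (a + 1, b + \<tau>) + m (a - 1, b + \<tau>) \<partial>lborel) * \<phi> (a, b)"
proof -
  obtain R where R: "R > 0" and vanish:
    "\<And>y. \<bar>fst y - a\<bar> \<ge> R \<or> \<bar>snd y - b\<bar> \<ge> R \<Longrightarrow> \<phi> y = 0 \<and> pd1 \<phi> y = 0 \<and> pd2 \<phi> y = 0"
    using test_function_vanish[OF \<phi>] by metis
  have inner: "(\<integral>x. \<bar>x - a\<bar> ^ (n + 1) *\<^sub>R (m (x, b + \<bar>x - a\<bar> ^ (n + 1) * \<tau>) *
      ((x - a) *\<^sub>R pd1 \<phi> (x, b + \<bar>x - a\<bar> ^ (n + 1) * \<tau>) +
       (real (n + 1) * (\<bar>x - a\<bar> ^ (n + 1) * \<tau>)) *\<^sub>R pd2 \<phi> (x, b + \<bar>x - a\<bar> ^ (n + 1) * \<tau>))) \<partial>lborel) =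
      (m (a + 1, b + \<tau>) + m (a - 1, b + \<tau>)) * - \<phi> (a, b)" (is "integral\<^sup>L _ ?H = _")
    if "\<tau> \<noteq> 0" for \<tau>
  proof -
    define P where "P s x = (x, b + (s * (x - a)) ^ (n + 1) * \<tau>)" for s x :: real
    define E where "E s x = pd1 \<phi> (P s x) + (s * real (n + 1) * (s * (x - a)) ^ n * \<tau>) *\<^sub>R pd2 \<phi> (P s x)"
      for s x :: real
    have [measurable]: "E s \<in> borel_measurable borel" for s
    proof -
      have "continuous_on UNIV (P s)" unfolding P_def by (intro continuous_intros)
      then show ?thesis
        unfolding E_def by (intro borel_measurable_continuous_onI continuous_intros
          continuous_on_compose2[OF test_functionD(2)[OF \<phi>]]
          continuous_on_compose2[OF test_functionD(3)[OF \<phi>]]) auto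
    qed
    have E_int: "integrable lborel (\<lambda>x. indicator {u..v} x *\<^sub>R E s x)" for s u v
    proof -
      have "continuous_on {u..v} (P s)" unfolding P_def by (intro continuous_intros)
      then have "continuous_on {u..v} (E s)"
        unfolding E_def by (intro continuous_intros
          continuous_on_compose2[OF test_functionD(2)[OF \<phi>]]
          continuous_on_compose2[OF test_functionD(3)[OF \<phi>]]) auto
      then show ?thesis using borel_integrable_compact[of "{u..v}" "E s"] by simp
    qed
    \<comment> \<open>Beyond distance \<open>R\<close> the curve has left the support; the minus
      sign on the left half-line is the sign of x - a.\<close>
    define H where "H x = m (a + 1, b + \<tau>) * (indicator {a..a+R} x *\<^sub>R E 1 x) -
      m (a - 1, b + \<tau>) * (indicator {a-R..a} x *\<^sub>R E (-1) x)" for x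
    have eq: "?H x = H x" if "x \<noteq> a" for x
    proof (cases "x > a")
      case True
      define r where "r = x - a"
      have r: "r > 0" "x = a + r" using True by (auto simp: r_def)
      have "?H x = m (a + 1, b + \<tau>) * E 1 x"
        using hom[of r \<tau>] r \<open>\<tau> \<noteq> 0\<close> by (simp add: E_def P_def scaleR_conv_of_real) (simp add: field_simps)
      moreover have "E 1 x = 0" if "x > a + R"
        using vanish[of "P 1 x"] that R by (simp add: E_def P_def abs_if)
      ultimately show ?thesis using True by (cases "x > a + R") (auto simp: H_def)
    next
      case False
      define r where "r = a - x"
      have r: "r > 0" "x = a - r" using False that by (auto simp: r_def)
      have "?H x = - m (a - 1, b + \<tau>) * E (-1) x"
        using hom[of "-r" \<tau>] r \<open>\<tau> \<noteq> 0\<close> by (simp add: E_def P_def scaleR_conv_of_real) (simp add: field_simps)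
      moreover have "E (-1) x = 0" if "x < a - R"
        using vanish[of "P (-1) x"] that R by (simp add: E_def P_def abs_if)
      ultimately show ?thesis using False that by (cases "x < a - R") (auto simp: H_def)
    qed
    have "integral\<^sup>L lborel ?H = integral\<^sup>L lborel H"
    proof (rule integral_cong_AE)
      show "H \<in> borel_measurable lborel" unfolding H_def by measurable
      \<comment> \<open>At x = a the factor |x - a|^(n+1) is 0, whatever the value of
        \<open>m\<close>. Measurability thus comes from \<open>H\<close>, in which \<open>m\<close>
        enters only through constants.\<close>
      have "?H = (\<lambda>x. if x = a then 0 else H x)" using eq by (auto simp: fun_eq_iff)
      also have "\<dots> \<in> borel_measurable lborel" unfolding H_def by measurable
      finally show "?H \<in> borel_measurable lborel" .
      show "AE x in lborel. ?H x = H x"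
        using AE_lborel_singleton[of a] by eventually_elim (rule eq)
    qed
    also have "\<dots> = m (a + 1, b + \<tau>) * (\<integral>x. indicator {a..a+R} x *\<^sub>R E 1 x \<partial>lborel) -
      m (a - 1, b + \<tau>) * (\<integral>x. indicator {a-R..a} x *\<^sub>R E (-1) x \<partial>lborel)"
      unfolding H_def
      by (subst Bochner_Integration.integral_diff; (intro integrable_mult_right E_int)?)
        (simp only: integral_mult_right_zero)
    also have "(\<integral>x. indicator {a..a+R} x *\<^sub>R E 1 x \<partial>lborel) = - \<phi> (a, b)"
      using integral_derivative_along_curve[OF \<phi>, of a "a + R" b 1 a n \<tau>] R vanish[of "P 1 (a + R)"]
      by (simp add: E_def P_def)
    also have "(\<integral>x. indicator {a-R..a} x *\<^sub>R E (-1) x \<partial>lborel) = \<phi> (a, b)"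
      using integral_derivative_along_curve[OF \<phi>, of "a - R" a b "-1" a n \<tau>] R vanish[of "P (-1) (a - R)"]
      by (simp add: E_def P_def)
    also have "m (a + 1, b + \<tau>) * - \<phi> (a, b) - m (a - 1, b + \<tau>) * \<phi> (a, b) =
        (m (a + 1, b + \<tau>) + m (a - 1, b + \<tau>)) * - \<phi> (a, b)"
      by (simp add: algebra_simps)
    finally show ?thesis .
  qed
  have "(\<integral>y. m y * ((fst y - a) *\<^sub>R pd1 \<phi> y + (real (n + 1) * (snd y - b)) *\<^sub>R pd2 \<phi> y) \<partial>lborel) =
      (\<integral>\<tau>. (m (a + 1, b + \<tau>) + m (a - 1, b + \<tau>)) * - \<phi> (a, b) \<partial>lborel)"
    unfolding shear_integral[OF int, where a = a and b = b and k = "n + 1"]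
  proof (rule integral_cong_AE)
    let ?F = "\<lambda>y. m y * ((fst y - a) *\<^sub>R pd1 \<phi> y + (real (n + 1) * (snd y - b)) *\<^sub>R pd2 \<phi> y)"
    let ?I = "\<lambda>\<tau>. \<integral>x. \<bar>x - a\<bar> ^ (n + 1) *\<^sub>R ?F (x, b + \<bar>x - a\<bar> ^ (n + 1) * \<tau>) \<partial>lborel"
    let ?J = "\<lambda>\<tau>. (m (a + 1, b + \<tau>) + m (a - 1, b + \<tau>)) * - \<phi> (a, b)"
    have IJ: "?I \<tau> = ?J \<tau>" if "\<tau> \<noteq> 0" for \<tau> using inner[OF that] by (simp only: fst_conv snd_conv add_diff_cancel_left')
    have "?F \<in> borel_measurable borel" using borel_measurable_integrable[OF int] by simp
    from measurable_compose_rev[OF this]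
    show I: "?I \<in> borel_measurable lborel" by measurable
    \<comment> \<open>Measurability of \<open>m\<close> on the two vertical lines is not assumed:
      off \<tau> = 0, \<open>?J\<close> is the parameter integral \<open>?I\<close> and takes its
      measurability from there.\<close>
    have "?J = (\<lambda>\<tau>. if \<tau> = 0 then ?J 0 else ?I \<tau>)" using IJ by (simp add: fun_eq_iff)
    also have "\<dots> \<in> borel_measurable lborel" using I by measurable
    finally show "?J \<in> borel_measurable lborel" .
    show "AE \<tau> in lborel. ?I \<tau> = ?J \<tau>"
      using AE_lborel_singleton[of 0] by eventually_elim (rule IJ)
  qed
  \<comment> \<open>The constant comes out of the integral unconditionally: if the remaining
    integrand is not integrable, both sides are 0 by the default value of the Bochner
    integral.\<close>
  then show ?thesis by simp
qed

section \<open>The candidate solution off the coordinate axes\<close>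

text \<open>A positive factor leaves the argument unchanged, so no branch correction appears in
  \<open>Ln\<close>.\<close>

lemma of_real_mult_powr:
  assumes "r > 0" "z \<noteq> 0"
  shows "(of_real r * z :: complex) powr of_real s = of_real (r powr s) * z powr of_real s"
proof -
  have "of_real (r powr s) = exp (of_real s * of_real (ln r) :: complex)"
    using assms by (simp add: powr_def flip: exp_of_real)
  then show ?thesis
    using assms by (simp add: powr_def Ln_times_of_real Ln_of_real ring_distribs exp_add)
qed

text \<open>The derivative is kept as logarithmic derivative times function, so that the powers need
  not be expanded later.\<close>

lemma has_vector_derivative_powr_mult_powr:
  fixes G H :: "real \<Rightarrow> complex" and \<alpha> \<beta> :: complex
  assumes G: "(G has_vector_derivative G') (at x)" "G x \<notin> \<real>\<^sub>\<le>\<^sub>0"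
    and H: "(H has_vector_derivative H') (at x)" "H x \<notin> \<real>\<^sub>\<le>\<^sub>0"
  shows "((\<lambda>t. G t powr \<alpha> * H t powr \<beta>) has_vector_derivative
    (\<alpha> * G' / G x + \<beta> * H' / H x) * (G x powr \<alpha> * H x powr \<beta>)) (at x)"
proof -
  have nz: "G x \<noteq> 0" "H x \<noteq> 0" using assms(2,4) by auto
  have "((\<lambda>t. G t powr \<alpha>) has_vector_derivative G' * (\<alpha> * G x powr (\<alpha> - 1))) (at x)"
    using field_vector_diff_chain_at[OF G(1) has_field_derivative_powr[OF G(2)]] by (simp add: o_def)
  moreover have "((\<lambda>t. H t powr \<beta>) has_vector_derivative H' * (\<beta> * H x powr (\<beta> - 1))) (at x)"
    using field_vector_diff_chain_at[OF H(1) has_field_derivative_powr[OF H(2)]] by (simp add: o_def)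
  ultimately have "((\<lambda>t. G t powr \<alpha> * H t powr \<beta>) has_vector_derivative
      G x powr \<alpha> * (H' * (\<beta> * H x powr (\<beta> - 1))) + G' * (\<alpha> * G x powr (\<alpha> - 1)) * H x powr \<beta>) (at x)"
    by (rule has_vector_derivative_mult)
  also have "G x powr \<alpha> * (H' * (\<beta> * H x powr (\<beta> - 1))) + G' * (\<alpha> * G x powr (\<alpha> - 1)) * H x powr \<beta> =
      (\<alpha> * G' / G x + \<beta> * H' / H x) * (G x powr \<alpha> * H x powr \<beta>)"
    using nz by (simp add: powr_diff field_simps)
  finally show ?thesis .
qed

section \<open>Exponents, weight and fluxes\<close>

locale grushin =
  fixes n :: nat and a b c p L :: real
  assumes n_ge_1: "n \<ge> 1" and c_nonzero: "c \<noteq> 0" and p_gt_1: "1 < p"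
    and L_ne: "L \<noteq> (real n + 2 - p) / (real n * (1 - p))"
begin

definition "\<alpha> = alpha_exp n p L"
definition "\<beta> = beta_exp n p L"
definition "\<sigma> = \<alpha> + \<beta>"

abbreviation "g \<equiv> g_fun a b c n"
abbreviation "h \<equiv> h_fun a b c n"
abbreviation "f \<equiv> f_sol a b c n p L"

text \<open>The points where \<open>f\<close> may fail to be differentiable all lie on the two lines removed here.\<close>

definition "U = {y :: real \<times> real. fst y \<noteq> a \<and> snd y \<noteq> b}"

text \<open>The constant in \<open>norm_hgrad_f\<close>: the root comes from the parallelogram law,
  the rest from the factor c (n+1) x^n common to both horizontal derivatives.\<close>

definition "\<kappa> = sqrt (2 * (\<alpha>\<^sup>2 + \<beta>\<^sup>2)) * \<bar>c\<bar> * real (n + 1)"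

text \<open>Closed form of the weight on \<open>U\<close>; unlike \<open>hgrad_weight\<close> it
  contains no pointwise derivative.\<close>

definition "w y = \<kappa> powr (p - 2) * \<bar>fst y - a\<bar> powr (real n * (p - 2)) *
  norm (g y) powr ((\<sigma> - 1) * (p - 2))"

text \<open>Logarithmic derivatives of \<open>f\<close> along \<open>Y1\<close> and
  \<open>Y2\<close>, divided by c (n+1) x^n and by \<i> c (n+1) x^n respectively.\<close>

definition "logd1 y = of_real \<alpha> / g y + of_real \<beta> / h y"
definition "logd2 y = of_real \<alpha> / g y - of_real \<beta> / h y"

definition "flux1 y = of_real (w y * c * real (n + 1) * (fst y - a) ^ n) * logd1 y * f y"
definition "flux2 y = \<i> * of_real (w y * c * real (n + 1) * (fst y - a) ^ n) * logd2 y * f y"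
definition "flux3 y = of_real (w y) * f y"

text \<open>The value of L excluded by \<open>L_ne\<close> is the zero of the numerator of \<alpha>.
  Hence \<kappa> > 0 and the gradient has no zero on \<open>U\<close>, which keeps its power p - 2
  nonsingular there even for p < 2.\<close>

lemma alpha_nonzero: "\<alpha> \<noteq> 0"
proof -
  have "L * (real n * (1 - p)) \<noteq> real n + 2 - p"
    using L_ne n_ge_1 p_gt_1 by (simp add: field_simps)
  then show ?thesis using n_ge_1 p_gt_1 by (simp add: \<alpha>_def alpha_exp_def mult.assoc)
qed

lemma kappa_pos: "\<kappa> > 0"
  using alpha_nonzero c_nonzero by (auto simp: \<kappa>_def add_pos_nonneg)

text \<open>The left side is the exponent of |g| in the first flux component. With x of degree 1 and
  g of degree n+1, the identity gives that component degree -(n+1), which leaves -(n+2) for the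
  Euler coefficient.\<close>

lemma sigma_eq: "(\<sigma> - 1) * (p - 1) = - (1 + real n * (p - 1) / real (n + 1))"
proof -
  have "\<sigma> = (real n + 2 - p) / (real (n + 1) * (1 - p))"
    using p_gt_1 unfolding \<sigma>_def \<alpha>_def \<beta>_def alpha_exp_def beta_exp_def
    by (simp add: divide_simps) (simp add: algebra_simps)
  then show ?thesis using p_gt_1 by (simp add: divide_simps) (simp add: algebra_simps)
qed

text \<open>L enters the exponents only through this difference, \<sigma> being free of it; the
  value is the one that cancels the commutator term in \<open>euler_coeff_flux23\<close>.\<close>

lemma alpha_minus_beta: "real (n + 1) * (\<alpha> - \<beta>) = - (L * real n)"
  using p_gt_1 unfolding \<alpha>_def \<beta>_def alpha_exp_def beta_exp_def
  by (simp add: divide_simps)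

lemma h_eq_cnj: "h y = cnj (g y)"
  by (simp add: g_fun_def h_fun_def complex_eq_iff)

lemma norm_h [simp]: "norm (h y) = norm (g y)"
  by (simp add: h_eq_cnj)

lemma
  assumes "y \<in> U"
  shows g_slit: "g y \<notin> \<real>\<^sub>\<le>\<^sub>0" and h_slit: "h y \<notin> \<real>\<^sub>\<le>\<^sub>0"
    and g_nonzero: "g y \<noteq> 0" and h_nonzero: "h y \<noteq> 0"
proof -
  have "Im (g y) \<noteq> 0" "Im (h y) \<noteq> 0" using assms by (auto simp: g_fun_def h_fun_def U_def)
  then show "g y \<notin> \<real>\<^sub>\<le>\<^sub>0" "h y \<notin> \<real>\<^sub>\<le>\<^sub>0" "g y \<noteq> 0" "h y \<noteq> 0"
    by (auto simp: complex_nonpos_Reals_iff)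
qed

text \<open>The exponents are real and |h| = |g|, so the choice of branch affects only the
  phase.\<close>

lemma norm_f: "norm (f y) = norm (g y) powr \<sigma>"
  by (simp add: f_sol_def norm_mult norm_powr_real_powr' \<alpha>_def \<beta>_def \<sigma>_def powr_add)

section \<open>Horizontal derivatives of the candidate and the closed form of the weight\<close>

lemma Y1_f:
  assumes "y \<in> U"
  shows "vf_apply Y1 f y = of_real (c * real (n + 1) * (fst y - a) ^ n) * logd1 y * f y"
proof -
  have "((\<lambda>t. c * (t - a) ^ (n + 1)) has_real_derivative c * real (n + 1) * (fst y - a) ^ n) (at (fst y))"
    by (auto intro!: derivative_eq_intros simp del: power_Suc)
  note d = has_vector_derivative_of_real[OF this]
  have "((\<lambda>t. g (t, snd y)) has_vector_derivative of_real (c * real (n + 1) * (fst y - a) ^ n)) (at (fst y))"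
    "((\<lambda>t. h (t, snd y)) has_vector_derivative of_real (c * real (n + 1) * (fst y - a) ^ n)) (at (fst y))"
    using has_vector_derivative_add[OF d has_vector_derivative_const]
      has_vector_derivative_diff[OF d has_vector_derivative_const]
    unfolding g_fun_def h_fun_def by simp_all
  from has_vector_derivative_powr_mult_powr[OF this(1) _ this(2), of "of_real \<alpha>" "of_real \<beta>"]
  have "((\<lambda>t. f (t, snd y)) has_vector_derivative
      (of_real \<alpha> * of_real (c * real (n + 1) * (fst y - a) ^ n) / g y +
       of_real \<beta> * of_real (c * real (n + 1) * (fst y - a) ^ n) / h y) * f y) (at (fst y))"
    using g_slit[OF assms] h_slit[OF assms] by (simp add: f_sol_def \<alpha>_def \<beta>_def)
  moreover have "(of_real \<alpha> * N / u + of_real \<beta> * N / v) * F = N * (of_real \<alpha> / u + of_real \<beta> / v) * F"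
    for N u v F :: complex by (simp add: algebra_simps)
  ultimately have "((\<lambda>t. f (t, snd y)) has_vector_derivative
      of_real (c * real (n + 1) * (fst y - a) ^ n) * logd1 y * f y) (at (fst y))"
    by (simp only: logd1_def)
  then show ?thesis by (simp add: vf_apply_def Y1_def pd1_def vector_derivative_at)
qed

lemma Y2_f:
  assumes "y \<in> U"
  shows "vf_apply (Y2 a c n) f y =
    \<i> * of_real (c * real (n + 1) * (fst y - a) ^ n) * logd2 y * f y"
proof -
  have "((\<lambda>t. g (fst y, t)) has_vector_derivative \<i> * of_real (real (n + 1))) (at (snd y))"
    "((\<lambda>t. h (fst y, t)) has_vector_derivative - (\<i> * of_real (real (n + 1)))) (at (snd y))"
    unfolding g_fun_def h_fun_def
    by (auto intro!: derivative_eq_intros has_vector_derivative_of_real)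
  from has_vector_derivative_powr_mult_powr[OF this(1) _ this(2), of "of_real \<alpha>" "of_real \<beta>"]
  have "((\<lambda>t. f (fst y, t)) has_vector_derivative
      (of_real \<alpha> * (\<i> * of_real (real (n + 1))) / g y +
       of_real \<beta> * - (\<i> * of_real (real (n + 1))) / h y) * f y) (at (snd y))"
    using g_slit[OF assms] h_slit[OF assms] by (simp add: f_sol_def \<alpha>_def \<beta>_def)
  moreover have "(of_real \<alpha> * N / u + of_real \<beta> * - N / v) * F = N * (of_real \<alpha> / u - of_real \<beta> / v) * F"
    for N u v F :: complex by (simp add: algebra_simps)
  ultimately have "((\<lambda>t. f (fst y, t)) has_vector_derivative
      \<i> * of_real (real (n + 1)) * logd2 y * f y) (at (snd y))"
    by (simp only: logd2_def)
  then show ?thesis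
    by (simp add: vf_apply_def Y2_def pd2_def vector_derivative_at scaleR_conv_of_real mult_ac)
qed

lemma norm_hgrad_f:
  assumes "y \<in> U"
  shows "norm (hgrad a c n f y) = \<kappa> * \<bar>fst y - a\<bar> ^ n * norm (g y) powr (\<sigma> - 1)"
proof (rule power2_eq_imp_eq)
  have g: "norm (g y) > 0" using g_nonzero[OF assms] by simp
  have "(norm (logd1 y))\<^sup>2 + (norm (logd2 y))\<^sup>2 = 2 * (\<alpha>\<^sup>2 + \<beta>\<^sup>2) / (norm (g y))\<^sup>2"
    (is "?l = _")
  proof -
    \<comment> \<open>The parallelogram law eliminates the cross term in \<alpha> \<beta>, so the
      gradient norm depends on |x| and |g| alone.\<close>
    have "(norm (u + v))\<^sup>2 + (norm (u - v))\<^sup>2 = 2 * ((norm u)\<^sup>2 + (norm v)\<^sup>2)" for u v :: complex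
      by (simp add: cmod_power2) (simp add: power2_eq_square algebra_simps)
    then have "?l = 2 * ((norm (of_real \<alpha> / g y))\<^sup>2 + (norm (of_real \<beta> / h y))\<^sup>2)"
      unfolding logd1_def logd2_def by blast
    also have "\<dots> = 2 * (\<alpha>\<^sup>2 + \<beta>\<^sup>2) / (norm (g y))\<^sup>2"
      by (simp add: norm_divide power_divide add_divide_distrib)
    finally show ?thesis .
  qed
  have "(norm (hgrad a c n f y))\<^sup>2 = (norm (vf_apply Y1 f y))\<^sup>2 + (norm (vf_apply (Y2 a c n) f y))\<^sup>2"
    by (simp add: hgrad_def norm_Pair)
  also have "\<dots> = (c * real (n + 1) * (fst y - a) ^ n)\<^sup>2 *
      ((norm (logd1 y))\<^sup>2 + (norm (logd2 y))\<^sup>2) * (norm (g y) powr \<sigma>)\<^sup>2"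
    unfolding Y1_f[OF assms] Y2_f[OF assms]
    by (simp only: norm_mult norm_of_real norm_f norm_ii power_mult_distrib power2_abs) (simp add: algebra_simps)
  also have "\<dots> = (\<kappa> * \<bar>fst y - a\<bar> ^ n * norm (g y) powr (\<sigma> - 1))\<^sup>2"
    using g unfolding \<open>?l = _\<close> \<kappa>_def
    by (simp only: power_mult_distrib power2_abs powr_diff power_divide powr_one real_sqrt_pow2
        power_even_abs power_abs[symmetric]) (simp add: field_simps power_mult_distrib)
  finally show "(norm (hgrad a c n f y))\<^sup>2 = (\<kappa> * \<bar>fst y - a\<bar> ^ n * norm (g y) powr (\<sigma> - 1))\<^sup>2" .
qed (use kappa_pos in auto)

lemma hgrad_weight_f:
  assumes "y \<in> U"
  shows "hgrad_weight a c n p f y = of_real (w y)"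
proof -
  have x: "\<bar>fst y - a\<bar> > 0" using assms by (simp add: U_def)
  have pos: "\<kappa> * \<bar>fst y - a\<bar> ^ n * norm (g y) powr (\<sigma> - 1) > 0"
    using kappa_pos x g_nonzero[OF assms] by simp
  \<comment> \<open>For positive z the convention at p = 2 agrees with \<open>powr\<close>, since
    then \<open>z powr 0 = 1\<close>.\<close>
  have "(if p = 2 then 1 else z powr (p - 2)) = z powr (p - 2)" if "z > 0" for z :: real
    using that by simp
  with pos have "hgrad_weight a c n p f y = of_real (norm (hgrad a c n f y) powr (p - 2))"
    unfolding hgrad_weight_def norm_hgrad_f[OF assms] by presburger
  also have "norm (hgrad a c n f y) powr (p - 2) = w y"
    using kappa_pos x
    by (simp add: norm_hgrad_f[OF assms] w_def powr_mult powr_powr powr_realpow[symmetric] mult_ac)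
  finally show ?thesis .
qed

lemma
  assumes "y \<in> U"
  shows flux1: "hgrad_weight a c n p f y * vf_apply Y1 f y = flux1 y"
    and flux2: "hgrad_weight a c n p f y * vf_apply (Y2 a c n) f y = flux2 y"
    and flux3: "hgrad_weight a c n p f y * f y = flux3 y"
  by (simp_all add: hgrad_weight_f[OF assms] Y1_f[OF assms] Y2_f[OF assms] flux1_def flux2_def flux3_def)

section \<open>Integrability\<close>

lemma open_U: "open U"
proof -
  have "U = {y. fst y \<noteq> a} \<inter> {y. snd y \<noteq> b}" by (auto simp: U_def)
  then show ?thesis
    by (auto intro!: open_Int open_Collect_neq continuous_intros)
qed

lemma AE_U: "AE y in lborel. y \<in> U"
  using lborel_AE_off_axes[of a b] by (simp add: U_def)

lemma continuous_on_flux: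
  "continuous_on U flux1" "continuous_on U flux2" "continuous_on U flux3"
proof -
  have g: "continuous_on U g" and h: "continuous_on U h"
    unfolding g_fun_def h_fun_def by (intro continuous_intros)+
  have "continuous_on U (\<lambda>y. g y powr of_real \<alpha>)" "continuous_on U (\<lambda>y. h y powr of_real \<beta>)"
    using g h g_slit h_slit g_nonzero h_nonzero
    by (auto intro!: continuous_on_powr_complex continuous_intros simp: complex_nonpos_Reals_iff)
  from continuous_on_mult[OF this] have f: "continuous_on U f"
    by (simp add: f_sol_def[abs_def] \<alpha>_def \<beta>_def)
  have w: "continuous_on U w"
    unfolding w_def using g_nonzero by (intro continuous_intros g) (auto simp: U_def)
  have logd: "continuous_on U logd1" "continuous_on U logd2"
    unfolding logd1_def logd2_def using g_nonzero h_nonzero by (auto intro!: continuous_intros g h)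
  show "continuous_on U flux1" "continuous_on U flux2" "continuous_on U flux3"
    unfolding flux1_def flux2_def flux3_def by (intro continuous_intros f w logd)+
qed

lemma norm_logd:
  "norm (logd1 y) \<le> (\<bar>\<alpha>\<bar> + \<bar>\<beta>\<bar>) / norm (g y)" "norm (logd2 y) \<le> (\<bar>\<alpha>\<bar> + \<bar>\<beta>\<bar>) / norm (g y)"
  unfolding logd1_def logd2_def
  using norm_triangle_ineq[of "of_real \<alpha> / g y" "of_real \<beta> / h y"]
    norm_triangle_ineq4[of "of_real \<alpha> / g y" "of_real \<beta> / h y"]
  by (simp_all add: norm_divide add_divide_distrib)

lemma w_mult_powr:
  "w y * norm (g y) powr \<sigma> = \<kappa> powr (p - 2) *
    (\<bar>fst y - a\<bar> powr (real n * (p - 2)) * norm (g y) powr (- (real n * (p - 1) / real (n + 1))))"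
proof -
  have "(\<sigma> - 1) * (p - 2) + \<sigma> = (\<sigma> - 1) * (p - 1) + 1" by (simp add: algebra_simps)
  also have "\<dots> = - (real n * (p - 1) / real (n + 1))" unfolding sigma_eq by simp
  finally show ?thesis by (simp add: w_def mult.assoc powr_add[symmetric])
qed

text \<open>By itself \<open>flux3\<close> behaves like |x|^(n (p - 2)) at the line x = 0, possibly
  not integrable for p near 1; the factor x^(n-1), taken from the coefficient of the commutator,
  raises the exponent to n (p - 1) - 1 > -1.\<close>

lemma norm_flux3:
  assumes "y \<in> U"
  shows "norm (flux3 y * of_real (fst y - a) ^ (n - 1)) \<le> \<kappa> powr (p - 2) *
    (\<bar>fst y - a\<bar> powr (real n * (p - 1) - 1) * norm (g y) powr (- (real n * (p - 1) / real (n + 1))))"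
proof -
  have x: "\<bar>fst y - a\<bar> > 0" using assms by (simp add: U_def)
  have w: "\<bar>w y\<bar> = w y" using kappa_pos by (simp add: w_def)
  have "real n * (p - 2) + real (n - 1) = real n * (p - 1) - 1"
    using n_ge_1 by (simp add: of_nat_diff algebra_simps)
  then have x': "\<bar>fst y - a\<bar> powr (real n * (p - 2)) * \<bar>fst y - a\<bar> ^ (n - 1) = \<bar>fst y - a\<bar> powr (real n * (p - 1) - 1)"
    using x by (simp only: powr_realpow[symmetric] powr_add[symmetric])
  have "norm (flux3 y * of_real (fst y - a) ^ (n - 1)) = w y * norm (g y) powr \<sigma> * \<bar>fst y - a\<bar> ^ (n - 1)"
    by (simp only: flux3_def norm_mult norm_of_real norm_power norm_f w)
  then show ?thesis unfolding w_mult_powr x'[symmetric] by (simp add: mult_ac)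
qed

lemma norm_flux12:
  assumes "y \<in> U"
  shows "norm (flux1 y) \<le> \<kappa> powr (p - 2) * \<bar>c\<bar> * real (n + 1) * (\<bar>\<alpha>\<bar> + \<bar>\<beta>\<bar>) *
      (\<bar>fst y - a\<bar> powr (real n * (p - 1)) * norm (g y) powr (- (1 + real n * (p - 1) / real (n + 1))))"
    (is "_ \<le> ?B")
    and "norm (flux2 y) \<le> \<kappa> powr (p - 2) * \<bar>c\<bar> * real (n + 1) * (\<bar>\<alpha>\<bar> + \<bar>\<beta>\<bar>) *
      (\<bar>fst y - a\<bar> powr (real n * (p - 1)) * norm (g y) powr (- (1 + real n * (p - 1) / real (n + 1))))"
proof -
  have x: "\<bar>fst y - a\<bar> > 0" using assms by (simp add: U_def)
  have w: "\<bar>w y\<bar> = w y" "w y \<ge> 0" using kappa_pos by (simp_all add: w_def)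
  have g: "norm (g y) > 0" using g_nonzero[OF assms] by simp
  have "real n * (p - 2) + real n = real n * (p - 1)" by (simp add: algebra_simps)
  then have x': "\<bar>fst y - a\<bar> powr (real n * (p - 2)) * \<bar>fst y - a\<bar> ^ n = \<bar>fst y - a\<bar> powr (real n * (p - 1))"
    using x by (simp only: powr_realpow[symmetric] powr_add[symmetric])
  \<comment> \<open>The factor 1 / |g| from the logarithmic derivatives lowers the exponent by
    1.\<close>
  have "- (1 + q) = - q - 1" for q :: real by simp
  then have g': "norm (g y) powr (- (real n * (p - 1) / real (n + 1))) / norm (g y) =
      norm (g y) powr (- (1 + real n * (p - 1) / real (n + 1)))"
    by (simp only: powr_diff powr_one[OF less_imp_le[OF g]])
  have eq: "w y * norm (g y) powr \<sigma> * \<bar>fst y - a\<bar> ^ n * \<bar>c\<bar> * real (n + 1) * ((\<bar>\<alpha>\<bar> + \<bar>\<beta>\<bar>) / norm (g y)) = ?B"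
    unfolding w_mult_powr x'[symmetric] g'[symmetric] by (simp only: times_divide_eq_left times_divide_eq_right mult_ac)
  have "norm (flux1 y) = w y * norm (g y) powr \<sigma> * \<bar>fst y - a\<bar> ^ n * \<bar>c\<bar> * real (n + 1) * norm (logd1 y)"
    by (simp only: flux1_def norm_mult norm_of_real norm_f abs_mult w power_abs abs_of_nat mult_ac)
  also have "\<dots> \<le> w y * norm (g y) powr \<sigma> * \<bar>fst y - a\<bar> ^ n * \<bar>c\<bar> * real (n + 1) * ((\<bar>\<alpha>\<bar> + \<bar>\<beta>\<bar>) / norm (g y))"
    by (intro mult_left_mono norm_logd mult_nonneg_nonneg w) auto
  finally show "norm (flux1 y) \<le> ?B" unfolding eq .
  have "norm (flux2 y) = w y * norm (g y) powr \<sigma> * \<bar>fst y - a\<bar> ^ n * \<bar>c\<bar> * real (n + 1) * norm (logd2 y)"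
    by (simp only: flux2_def norm_mult norm_of_real norm_f abs_mult w power_abs abs_of_nat norm_ii mult_1 mult_ac)
  also have "\<dots> \<le> w y * norm (g y) powr \<sigma> * \<bar>fst y - a\<bar> ^ n * \<bar>c\<bar> * real (n + 1) * ((\<bar>\<alpha>\<bar> + \<bar>\<beta>\<bar>) / norm (g y))"
    by (intro mult_left_mono norm_logd mult_nonneg_nonneg w) auto
  finally show "norm (flux2 y) \<le> ?B" unfolding eq .
qed

text \<open>Distributing the exponent over both coordinates separates the variables in the bounds above.\<close>

lemma norm_g_powr_le:
  assumes "y \<in> U" "0 \<le> s" "s \<le> S"
  shows "norm (g y) powr (- S) \<le> \<bar>c\<bar> powr (- s) *
    (\<bar>fst y - a\<bar> powr (- (real (n + 1) * s)) * \<bar>snd y - b\<bar> powr (- (S - s)))"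
proof -
  have x: "\<bar>fst y - a\<bar> > 0" and t: "\<bar>snd y - b\<bar> > 0" using assms by (simp_all add: U_def)
  have "\<bar>c\<bar> * \<bar>fst y - a\<bar> ^ (n + 1) \<le> norm (g y)"
    using abs_Re_le_cmod[of "g y"] by (simp add: g_fun_def abs_mult power_abs)
  then have "norm (g y) powr (- s) \<le> (\<bar>c\<bar> * \<bar>fst y - a\<bar> ^ (n + 1)) powr (- s)"
    using x c_nonzero assms(2) by (intro powr_mono2') auto
  also have "\<dots> = \<bar>c\<bar> powr (- s) * \<bar>fst y - a\<bar> powr (- (real (n + 1) * s))"
    using x by (simp only: powr_mult powr_realpow[OF x, symmetric] powr_powr mult_minus_right)
  finally have 1: "norm (g y) powr (- s) \<le> \<bar>c\<bar> powr (- s) * \<bar>fst y - a\<bar> powr (- (real (n + 1) * s))" .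
  have "1 * \<bar>snd y - b\<bar> \<le> real (n + 1) * \<bar>snd y - b\<bar>" by (intro mult_right_mono) auto
  also have "\<dots> \<le> norm (g y)"
    using abs_Im_le_cmod[of "g y"] by (simp add: g_fun_def abs_mult add.commute)
  finally have "norm (g y) powr (- (S - s)) \<le> \<bar>snd y - b\<bar> powr (- (S - s))"
    using t assms(3) by (intro powr_mono2') auto
  with 1 have "norm (g y) powr (- s) * norm (g y) powr (- (S - s)) \<le>
      \<bar>c\<bar> powr (- s) * \<bar>fst y - a\<bar> powr (- (real (n + 1) * s)) * \<bar>snd y - b\<bar> powr (- (S - s))"
    by (intro mult_mono) auto
  then show ?thesis by (simp add: powr_add[symmetric] mult.assoc)
qed

text \<open>The parameter s is the part of the exponent S charged to |x|^(n+1), the rest going to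
  |t| by \<open>norm_g_powr_le\<close>. The conditions on s say that the resulting powers of |x| and
  |t| are locally integrable; the bounded support of \<xi> does the rest. The integral moves to
  \<open>lborel\<close> with the values off \<open>U\<close> set to 0.\<close>

lemma singular_integral:
  fixes u E \<xi> :: "real \<times> real \<Rightarrow> complex"
  assumes u: "\<And>y. y \<in> U \<Longrightarrow> u y = E y * \<xi> y"
    and E: "continuous_on U E"
    and bound: "\<And>y. y \<in> U \<Longrightarrow>
      norm (E y) \<le> B * (\<bar>fst y - a\<bar> powr P * norm (g y) powr (- S))"
    and B: "B \<ge> 0" and s: "0 \<le> s" "s \<le> S" "S - s < 1" "P - real (n + 1) * s > -1"
    and \<xi>: "continuous_on UNIV \<xi>" "\<And>y. \<bar>fst y - a\<bar> \<ge> R \<or> \<bar>snd y - b\<bar> \<ge> R \<Longrightarrow> \<xi> y = 0"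
    and R: "R > 0"
  shows "integrable lebesgue u" "integrable lborel (\<lambda>y. indicator U y *\<^sub>R (E y * \<xi> y))"
    "integral\<^sup>L lebesgue u = (\<integral>y. indicator U y *\<^sub>R (E y * \<xi> y) \<partial>lborel)"
proof -
  let ?v = "\<lambda>y. indicator U y *\<^sub>R (E y * \<xi> y)"
  obtain N where N: "N > 0" "\<And>y. norm (\<xi> y) \<le> N" using continuous_bounded_vanish[OF \<xi>] by metis
  let ?D = "\<lambda>y. (indicator {a-R..a+R} (fst y) * \<bar>fst y - a\<bar> powr (P - real (n + 1) * s)) *
      (indicator {b-R..b+R} (snd y) * \<bar>snd y - b\<bar> powr (- (S - s)))"
  have v: "?v \<in> borel_measurable borel"
    using open_U by (intro borel_measurable_continuous_on_indicator continuous_intros E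
        continuous_on_subset[OF \<xi>(1)]) auto
  have D: "integrable lborel ?D"
    by (rule integrable_product_powr) (use s R in auto)
  show int: "integrable lborel ?v"
  proof (rule Bochner_Integration.integrable_bound)
    show "integrable lborel (\<lambda>y. B * \<bar>c\<bar> powr (- s) * N * ?D y)" using D by simp
    show "?v \<in> borel_measurable lborel" using v by simp
    have "norm (?v y) \<le> norm (B * \<bar>c\<bar> powr (- s) * N * ?D y)" for y
    proof (cases "y \<in> U \<and> \<bar>fst y - a\<bar> \<le> R \<and> \<bar>snd y - b\<bar> \<le> R")
      case True
      have "norm (E y) * norm (\<xi> y) \<le> (B * (\<bar>fst y - a\<bar> powr P * (\<bar>c\<bar> powr (- s) *
          (\<bar>fst y - a\<bar> powr (- (real (n + 1) * s)) * \<bar>snd y - b\<bar> powr (- (S - s)))))) * N"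
        using True N B
        by (intro mult_mono order_trans[OF bound] mult_left_mono norm_g_powr_le s) auto
      also have "\<dots> = B * \<bar>c\<bar> powr (- s) * N * ((\<bar>fst y - a\<bar> powr P * \<bar>fst y - a\<bar> powr (- (real (n + 1) * s))) *
          \<bar>snd y - b\<bar> powr (- (S - s)))" by (simp only: mult_ac)
      also have "\<dots> = B * \<bar>c\<bar> powr (- s) * N * ?D y"
        using True by (simp add: powr_add[symmetric] indicator_def abs_le_iff)
      finally show ?thesis using True by (simp add: norm_mult)
    next
      case False
      then have "?v y = 0" using \<xi>(2)[of y] by (cases "y \<in> U") auto
      then show ?thesis by (simp only: norm_zero norm_ge_zero)
    qed
    then show "AE y in lborel. norm (?v y) \<le> norm (B * \<bar>c\<bar> powr (- s) * N * ?D y)" by simp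
  qed
  have ae: "AE y in lebesgue. ?v y = u y"
    using AE_U unfolding AE_completion_iff by eventually_elim (simp add: u)
  have vl: "?v \<in> borel_measurable lebesgue" using v by (intro measurable_completion) simp
  \<comment> \<open>No hypothesis controls \<open>u\<close> off \<open>U\<close>. Its preimages
    agree almost everywhere with those of the Borel function \<open>?v\<close>, hence are measurable
    for the completed measure.\<close>
  have um: "u \<in> borel_measurable lebesgue"
  proof (rule measurableI)
    fix A :: "complex set" assume "A \<in> sets borel"
    then have A: "?v -` A \<inter> space lebesgue \<in> sets lebesgue" by (rule measurable_sets[OF vl])
    have "AE y in lebesgue. y \<in> ?v -` A \<inter> space lebesgue \<longleftrightarrow> y \<in> u -` A \<inter> space lebesgue"
      using ae by eventually_elim simp
    then show "u -` A \<inter> space lebesgue \<in> sets lebesgue"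
      by (rule completion.in_sets_AE) (use A in auto)
  qed simp
  have "integrable lebesgue ?v" using int v by (subst integrable_completion) auto
  then show "integrable lebesgue u" by (rule integrable_cong_AE_imp[OF _ um ae])
  have "integral\<^sup>L lebesgue u = integral\<^sup>L lebesgue ?v"
    using ae by (intro integral_cong_AE um vl) (auto elim: eventually_mono)
  also have "\<dots> = integral\<^sup>L lborel ?v" using v by (intro integral_completion) simp
  finally show "integral\<^sup>L lebesgue u = integral\<^sup>L lborel ?v" .
qed

section \<open>The flux as a multiple of the Euler field\<close>

text \<open>The multiplier of the Euler field: \<open>flux1\<close> divided by x, written with the
  power n - 1 to avoid a division at x = 0.\<close>

definition "euler_coeff y =
  of_real (w y * c * real (n + 1) * (fst y - a) ^ (n - 1)) * logd1 y * f y"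

lemma euler_coeff_flux1:
  "flux1 y = of_real (fst y - a) * euler_coeff y"
proof -
  have "(fst y - a) ^ n = (fst y - a) * (fst y - a) ^ (n - 1)"
    using n_ge_1 by (simp add: power_eq_if)
  then show ?thesis by (simp add: flux1_def euler_coeff_def)
qed

text \<open>The commutator term is exactly what makes the flux parallel to the Euler field.\<close>

lemma euler_coeff_flux23:
  assumes "y \<in> U"
  shows "of_real (c * (fst y - a) ^ n) * flux2 y +
      \<i> * of_real (L * (c * real n * (fst y - a) ^ (n - 1))) * flux3 y =
    of_real (real (n + 1) * (snd y - b)) * euler_coeff y"
proof -
  let ?X = "of_real (c * (fst y - a) ^ (n + 1)) :: complex"
  let ?T = "\<i> * of_real (real (n + 1) * (snd y - b)) :: complex"
  have xn: "(fst y - a) ^ n = (fst y - a) * (fst y - a) ^ (n - 1)"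
    using n_ge_1 by (simp add: power_eq_if)
  have g: "g y = ?X + ?T" and h: "h y = ?X - ?T" by (simp_all add: g_fun_def h_fun_def)
  have nz: "g y \<noteq> 0" "h y \<noteq> 0" using g_nonzero h_nonzero assms by auto
  have "of_real (real (n + 1) * (\<alpha> - \<beta>)) = (- of_real (L * real n) :: complex)"
    unfolding alpha_minus_beta by simp
  then have ab: "of_real (L * real n) = - (of_real (real (n + 1)) * (of_real \<alpha> - of_real \<beta>) :: complex)"
    by simp
  have key: "of_real (real (n + 1)) * ?X * logd2 y + of_real (L * real n) =
      - (of_real (real (n + 1)) * ?T * logd1 y)"
  proof -
    have "?X * logd2 y - (of_real \<alpha> - of_real \<beta>) = - (?T * logd1 y)"
    proof -
      \<comment> \<open>Writing X as (X + T) - T over the first denominator and as (X - T) + T over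
        the second produces the constant A - B; this is what the commutator term, a multiple of
        \<alpha> - \<beta>, cancels.\<close>
      have "X * (A / (X + T) - B / (X - T)) - (A - B) = - (T * (A / (X + T) + B / (X - T)))"
        if "X + T \<noteq> 0" "X - T \<noteq> 0" for X T A B :: complex
        using that by (simp add: divide_simps) (simp add: algebra_simps)
      then show ?thesis unfolding logd1_def logd2_def using nz unfolding g h by blast
    qed
    moreover have "N * X * l2 + - (N * d) = - (N * T * l1)" if "X * l2 - d = - (T * l1)" for N X T l1 l2 d :: complex
      using arg_cong[OF that, of "(*) N"] by (simp add: algebra_simps)
    ultimately show ?thesis unfolding ab by blast
  qed
  let ?q = "\<i> * of_real (w y * c * (fst y - a) ^ (n - 1)) * f y"
  have "of_real (c * (fst y - a) ^ n) * flux2 y +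
      \<i> * of_real (L * (c * real n * (fst y - a) ^ (n - 1))) * flux3 y =
      ?q * (of_real (real (n + 1)) * ?X * logd2 y + of_real (L * real n))"
    by (simp add: flux2_def flux3_def xn algebra_simps)
  also have "\<dots> = of_real (real (n + 1) * (snd y - b)) * euler_coeff y"
    unfolding key euler_coeff_def by (simp add: algebra_simps)
  finally show ?thesis .
qed

text \<open>The dilation multiplies g and h by the same positive number r^(n+1), so the complex
  powers scale without branch correction, also where c x^(n+1) < 0. The rest is adding
  exponents.\<close>

lemma euler_coeff_homogeneous:
  assumes "x \<noteq> 0" "\<tau> \<noteq> 0"
  shows "euler_coeff (a + x, b + \<bar>x\<bar> ^ (n + 1) * \<tau>) = euler_coeff (a + sgn x, b + \<tau>) /\<^sub>R \<bar>x\<bar> ^ (n + 2)"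
proof -
  define r where "r = \<bar>x\<bar>"
  define y where "y = (a + x, b + \<bar>x\<bar> ^ (n + 1) * \<tau>)"
  define z where "z = (a + sgn x, b + \<tau>)"
  \<comment> \<open>A \<open>powr\<close> rather than a natural power, so that all factors become
    real powers of r whose exponents add.\<close>
  define R where "R = r powr real (n + 1)"
  have r: "r > 0" using assms by (simp add: r_def)
  have R: "R > 0" "R = r ^ (n + 1)" using r powr_realpow[OF r, of "n + 1"] by (simp_all add: R_def)
  have x: "x = r * sgn x" by (metis r_def sgn_mult_abs mult.commute)
  have zU: "z \<in> U" using assms by (simp add: z_def U_def sgn_0_0)
  have xp: "x ^ k = r ^ k * sgn x ^ k" for k by (subst x) (simp add: power_mult_distrib)
  have g: "g y = of_real R * g z" and h: "h y = of_real R * h z"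
    by (simp_all only: g_fun_def h_fun_def y_def z_def fst_conv snd_conv add_diff_cancel_left'
        r_def[symmetric] xp R(2)[symmetric]) (simp_all add: algebra_simps)
  have f: "f y = of_real (R powr \<sigma>) * f z"
    using R(1) g_nonzero[OF zU] h_nonzero[OF zU] unfolding f_sol_def g h
    by (simp add: of_real_mult_powr \<alpha>_def \<beta>_def \<sigma>_def powr_add)
  have l: "logd1 y = of_real (R powr (-1)) * logd1 z"
    using R(1) by (simp add: logd1_def g h powr_minus_divide field_simps)
  have w: "w y = r powr (real n * (p - 2)) * R powr ((\<sigma> - 1) * (p - 2)) * w z"
    using R(1) assms(1)
    by (simp add: w_def g norm_mult powr_mult) (simp add: y_def z_def r_def abs_sgn_eq)
  have xn: "(fst y - a) ^ (n - 1) = r powr (real (n - 1)) * (fst z - a) ^ (n - 1)"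
    using r by (simp add: y_def z_def xp powr_realpow)
  \<comment> \<open>The exponents come, in order, from |x| and |g| in the weight, from x^(n-1), from
    the logarithmic derivative and from \<open>f\<close>.\<close>
  have "real n * (p - 2) + real (n + 1) * ((\<sigma> - 1) * (p - 2)) + real (n - 1) + real (n + 1) * (- 1) + real (n + 1) * \<sigma>
      = real n * (p - 2) + real (n - 1) + real (n + 1) * ((\<sigma> - 1) * (p - 1))"
    by (simp add: algebra_simps)
  also have "\<dots> = - real (n + 2)"
    unfolding sigma_eq using n_ge_1 by (simp add: of_nat_diff field_simps)
  finally have "r powr (real n * (p - 2)) * R powr ((\<sigma> - 1) * (p - 2)) * r powr (real (n - 1)) * R powr (-1) * R powr \<sigma>
      = r powr (- real (n + 2))"
    unfolding R_def powr_powr powr_add[symmetric] by (simp only:)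
  also have "\<dots> = inverse (r ^ (n + 2))"
    using r by (simp only: powr_minus powr_realpow)
  finally have "inverse (r ^ (n + 2)) = r powr (real n * (p - 2)) * R powr ((\<sigma> - 1) * (p - 2)) *
      r powr (real (n - 1)) * R powr (-1) * R powr \<sigma>" ..
  then have "euler_coeff y = euler_coeff z /\<^sub>R r ^ (n + 2)"
    unfolding euler_coeff_def w xn l f scaleR_conv_of_real by (simp only: of_real_mult mult_ac)
  then show ?thesis by (simp add: y_def z_def r_def)
qed

section \<open>The operator paired with a test function\<close>

lemma G_op_f:
  assumes \<phi>: "test_function \<phi>"
  shows "integrable lebesgue (\<lambda>y. hgrad_weight a c n p f y * vf_apply Y1 f y * vf_transpose Y1 \<phi> y)" (is ?I1)
    and "integrable lebesgue (\<lambda>y. hgrad_weight a c n p f y * vf_apply (Y2 a c n) f y * vf_transpose (Y2 a c n) \<phi> y)" (is ?I2)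
    and "integrable lebesgue (\<lambda>y. hgrad_weight a c n p f y * f y * vf_transpose (lie_bracket Y1 (Y2 a c n)) \<phi> y)" (is ?I3)
    and "G_op a c n p L f \<phi> =
      (\<integral>\<tau>. indicator U (a + 1, b + \<tau>) * euler_coeff (a + 1, b + \<tau>) +
        indicator U (a - 1, b + \<tau>) * euler_coeff (a - 1, b + \<tau>) \<partial>lborel) * dirac (a, b) \<phi>" (is ?G)
proof -
  obtain R where R: "R > 0" and vanish:
    "\<And>y. \<bar>fst y - a\<bar> \<ge> R \<or> \<bar>snd y - b\<bar> \<ge> R \<Longrightarrow> \<phi> y = 0 \<and> pd1 \<phi> y = 0 \<and> pd2 \<phi> y = 0"
    using test_function_vanish[OF \<phi>] by metis
  note cont = test_functionD(2,3)[OF \<phi>]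
  define q where "q = real n * (p - 1)"
  have q: "q > 0" using n_ge_1 p_gt_1 by (simp add: q_def)
  have t1: "vf_transpose Y1 \<phi> y = - pd1 \<phi> y" for y
    by (simp add: vf_transpose_def Y1_def pd2_def)
  \<comment> \<open>The coefficients of \<open>Y2\<close> and of the commutator depend only on the
    first coordinate, so transposing these fields merely changes the sign.\<close>
  have pd2_mult: "pd2 (\<lambda>z. k (fst z) *\<^sub>R \<phi> z) y = k (fst y) *\<^sub>R pd2 \<phi> y" for k y
  proof -
    have "(\<phi> has_derivative (\<lambda>v. fst v *\<^sub>R pd1 \<phi> y + snd v *\<^sub>R pd2 \<phi> y)) (at (fst y, snd y))"
      using has_derivative_pd[OF test_functionD(1)[OF \<phi>], of y] by simp
    from has_derivative_compose[OF has_derivative_Pair[OF has_derivative_const has_derivative_ident] this]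
    have "((\<lambda>t. \<phi> (fst y, t)) has_derivative (\<lambda>h. h *\<^sub>R pd2 \<phi> y)) (at (snd y))"
      by simp
    then have "((\<lambda>t. k (fst y) *\<^sub>R \<phi> (fst y, t)) has_vector_derivative k (fst y) *\<^sub>R pd2 \<phi> y) (at (snd y))"
      by (auto simp: has_vector_derivative_def intro!: derivative_eq_intros)
    then show ?thesis by (simp add: pd2_def vector_derivative_at)
  qed
  have t2: "vf_transpose (Y2 a c n) \<phi> y = - of_real (c * (fst y - a) ^ n) * pd2 \<phi> y" for y
    using pd2_mult[of "\<lambda>x. c * (x - a) ^ n" y]
    by (simp add: vf_transpose_def Y2_def pd1_def scaleR_conv_of_real)
  have t3: "vf_transpose (lie_bracket Y1 (Y2 a c n)) \<phi> y =
      - of_real (c * real n * (fst y - a) ^ (n - 1)) * pd2 \<phi> y" for y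
    using pd2_mult[of "\<lambda>x. c * real n * (x - a) ^ (n - 1)" y]
    unfolding vf_transpose_def lie_bracket_Y1_Y2 by (simp add: pd1_def scaleR_conv_of_real)
  \<comment> \<open>With S = 1 + q / (n+1) this leaves the exponents -1/2 for |x| and -1 + 1 / (2
    (n+1)) for |t|, both above -1.\<close>
  define s1 where "s1 = (q + 1/2) / real (n + 1)"
  have s1: "0 \<le> s1" "s1 \<le> 1 + q / real (n + 1)" "1 + q / real (n + 1) - s1 < 1"
    "q - real (n + 1) * s1 > -1"
  proof -
    have "s1 = q / real (n + 1) + 1 / (2 * real (n + 1))" "real (n + 1) * s1 = q + 1 / 2"
      by (simp add: s1_def add_divide_distrib) (simp add: s1_def)
    moreover have "0 < 1 / (2 * real (n + 1))" "1 / (2 * real (n + 1)) \<le> 1" "0 < q / real (n + 1)"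
      using q by simp_all
    ultimately show "0 \<le> s1" "s1 \<le> 1 + q / real (n + 1)" "1 + q / real (n + 1) - s1 < 1"
      "q - real (n + 1) * s1 > -1" by linarith+
  qed
  \<comment> \<open>For the third term the exponents become (n+1) \<delta> - 1 for |x| and -\<delta>
    for |t|: 0 < \<delta> < 1 makes both integrable, and \<delta> \<le> q / (n+1) keeps
    \<open>s3\<close> nonnegative.\<close>
  have "0 < min (q / real (n + 1)) 1" using q by simp
  then obtain \<delta> where "0 < \<delta>" "\<delta> < min (q / real (n + 1)) 1" using dense by blast
  then have \<delta>: "0 < \<delta>" "\<delta> \<le> q / real (n + 1)" "\<delta> < 1" by auto
  define s3 where "s3 = q / real (n + 1) - \<delta>"
  have s3: "0 \<le> s3" "s3 \<le> q / real (n + 1)" "q / real (n + 1) - s3 < 1"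
    "(q - 1) - real (n + 1) * s3 > -1"
    using \<delta> by (simp_all add: s3_def right_diff_distrib)
  note i1 = singular_integral[where E = flux1 and \<xi> = "\<lambda>y. - pd1 \<phi> y" and P = q and S = "1 + q / real (n + 1)",
      OF _ continuous_on_flux(1) norm_flux12(1)[folded q_def] _ s1 _ _ R,
      where u = "\<lambda>y. hgrad_weight a c n p f y * vf_apply Y1 f y * vf_transpose Y1 \<phi> y"]
  note i2 = singular_integral[where E = flux2 and \<xi> = "\<lambda>y. - of_real (c * (fst y - a) ^ n) * pd2 \<phi> y"
      and P = q and S = "1 + q / real (n + 1)",
      OF _ continuous_on_flux(2) norm_flux12(2)[folded q_def] _ s1 _ _ R,
      where u = "\<lambda>y. hgrad_weight a c n p f y * vf_apply (Y2 a c n) f y * vf_transpose (Y2 a c n) \<phi> y"]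
  \<comment> \<open>The factor x^(n-1) of the commutator coefficient is moved from the test function
    to the flux, as \<open>norm_flux3\<close> requires.\<close>
  have c3: "continuous_on U (\<lambda>y. flux3 y * of_real (fst y - a) ^ (n - 1))"
    by (intro continuous_intros continuous_on_flux)
  note i3 = singular_integral[where E = "\<lambda>y. flux3 y * of_real (fst y - a) ^ (n - 1)"
      and \<xi> = "\<lambda>y. - of_real (c * real n) * pd2 \<phi> y" and P = "q - 1" and S = "q / real (n + 1)",
      OF _ c3 norm_flux3[folded q_def] _ s3 _ _ R,
      where u = "\<lambda>y. hgrad_weight a c n p f y * f y * vf_transpose (lie_bracket Y1 (Y2 a c n)) \<phi> y"]
  have I1: ?I1 "integrable lborel (\<lambda>y. indicator U y *\<^sub>R (flux1 y * - pd1 \<phi> y))"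
    "vf_distr Y1 (\<lambda>y. hgrad_weight a c n p f y * vf_apply Y1 f y) \<phi> =
      (\<integral>y. indicator U y *\<^sub>R (flux1 y * - pd1 \<phi> y) \<partial>lborel)"
    unfolding vf_distr_def
    by (rule i1; (intro continuous_intros cont | simp add: flux1 t1 vanish kappa_pos less_imp_le))+
  have I2: ?I2 "integrable lborel (\<lambda>y. indicator U y *\<^sub>R (flux2 y * (- of_real (c * (fst y - a) ^ n) * pd2 \<phi> y)))"
    "vf_distr (Y2 a c n) (\<lambda>y. hgrad_weight a c n p f y * vf_apply (Y2 a c n) f y) \<phi> =
      (\<integral>y. indicator U y *\<^sub>R (flux2 y * (- of_real (c * (fst y - a) ^ n) * pd2 \<phi> y)) \<partial>lborel)"
    unfolding vf_distr_def
    by (rule i2; (intro continuous_intros cont | simp add: flux2 t2 vanish kappa_pos less_imp_le))+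
  have I3: ?I3 "integrable lborel (\<lambda>y. indicator U y *\<^sub>R
      (flux3 y * of_real (fst y - a) ^ (n - 1) * (- of_real (c * real n) * pd2 \<phi> y)))"
    "vf_distr (lie_bracket Y1 (Y2 a c n)) (\<lambda>y. hgrad_weight a c n p f y * f y) \<phi> =
      (\<integral>y. indicator U y *\<^sub>R
        (flux3 y * of_real (fst y - a) ^ (n - 1) * (- of_real (c * real n) * pd2 \<phi> y)) \<partial>lborel)"
    unfolding vf_distr_def
    by (rule i3; (intro continuous_intros cont | simp add: flux3 t3 vanish kappa_pos less_imp_le))+
  show ?I1 ?I2 ?I3 by (fact I1(1) I2(1) I3(1))+
  \<comment> \<open>The indicator matches the one produced by \<open>singular_integral\<close>;
    homogeneity survives because the dilations about (a, b) preserve \<open>U\<close>.\<close>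
  define m where "m y = indicator U y * euler_coeff y" for y
  have sum: "indicator U y *\<^sub>R (flux1 y * - pd1 \<phi> y) +
      indicator U y *\<^sub>R (flux2 y * (- of_real (c * (fst y - a) ^ n) * pd2 \<phi> y)) +
      \<i> * of_real L * (indicator U y *\<^sub>R
        (flux3 y * of_real (fst y - a) ^ (n - 1) * (- of_real (c * real n) * pd2 \<phi> y))) =
      - (m y * ((fst y - a) *\<^sub>R pd1 \<phi> y + (real (n + 1) * (snd y - b)) *\<^sub>R pd2 \<phi> y))" (is "?S y = ?M y") for y
  proof (cases "y \<in> U")
    case True
    \<comment> \<open>Collecting the coefficients of the two partial derivatives exhibits the whole
      flux, whose components are x and (n+1) t times \<open>euler_coeff\<close>.\<close>
    have "?S y = - (flux1 y * pd1 \<phi> y + (of_real (c * (fst y - a) ^ n) * flux2 y +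
        \<i> * of_real (L * (c * real n * (fst y - a) ^ (n - 1))) * flux3 y) * pd2 \<phi> y)"
      using True by (simp add: algebra_simps)
    also have "\<dots> = ?M y"
      unfolding euler_coeff_flux23[OF True] euler_coeff_flux1
      using True by (simp add: m_def scaleR_conv_of_real algebra_simps)
    finally show ?thesis .
  qed (simp add: m_def)
  have int: "integrable lborel ?S"
    by (intro Bochner_Integration.integrable_add integrable_mult_right I1(2) I2(2) I3(2))
  have "G_op a c n p L f \<phi> = integral\<^sup>L lborel ?S"
    unfolding G_op_def p_laplacian_def I1(3) I2(3) I3(3)
    by (simp only: Bochner_Integration.integral_add Bochner_Integration.integrable_add integrable_mult_right
        I1(2) I2(2) I3(2) integral_mult_right_zero)
  also have "\<dots> = - (\<integral>y. m y * ((fst y - a) *\<^sub>R pd1 \<phi> y + (real (n + 1) * (snd y - b)) *\<^sub>R pd2 \<phi> y) \<partial>lborel)"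
    unfolding sum by (rule integral_minus)
  \<comment> \<open>The minus sign of the transposes cancels the one from the half-line integrals;
    the constant is the integral of the multiplier over the two lines at distance 1 from x =
    0.\<close>
  also have "\<dots> = (\<integral>\<tau>. m (a + 1, b + \<tau>) + m (a - 1, b + \<tau>) \<partial>lborel) * \<phi> (a, b)"
  proof (subst integral_homogeneous_euler[OF \<phi>])
    fix x \<tau> :: real assume nz: "x \<noteq> 0" "\<tau> \<noteq> 0"
    then have "(a + x, b + \<bar>x\<bar> ^ (n + 1) * \<tau>) \<in> U" "(a + sgn x, b + \<tau>) \<in> U"
      by (auto simp: U_def sgn_0_0)
    then show "m (a + x, b + \<bar>x\<bar> ^ (n + 1) * \<tau>) = m (a + sgn x, b + \<tau>) /\<^sub>R \<bar>x\<bar> ^ (n + 2)"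
      unfolding m_def euler_coeff_homogeneous[OF nz] by simp
  next
    show "integrable lborel (\<lambda>y. m y * ((fst y - a) *\<^sub>R pd1 \<phi> y + (real (n + 1) * (snd y - b)) *\<^sub>R pd2 \<phi> y))"
      using int unfolding sum by simp
  qed simp
  finally show ?G by (simp add: m_def dirac_def)
qed

end

theorem theorem5p1:
  fixes n :: nat and a b c p L :: real
  assumes "n \<ge> 1" and "c \<noteq> 0" and "1 < p"
    and "L \<noteq> (real n + 2 - p) / (real n * (1 - p))"
    and "L \<noteq> - ((real n + 2 - p) / (real n * (1 - p)))"
  shows "G_op_defined a c n p (f_sol a b c n p L) \<and>
    (\<exists>C :: complex. \<forall>\<phi>. test_function \<phi> \<longrightarrow>
       G_op a c n p L (f_sol a b c n p L) \<phi> = C * dirac (a, b) \<phi>)"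
proof -
  interpret grushin n a b c p L using assms by unfold_locales
  show ?thesis
    unfolding G_op_defined_def vf_distr_defined_def using G_op_f by blast
qed

end
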